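(* For all $n\ge 2$, $\mathcal{IC}_n$ is an ample semigroup.
   Context: Let $[n]=\{1,2,\ldots,n\}$ with its usual order. $\mathcal{IC}_n$ is the monoid of all injective partial transformations $\alpha$ of $[n]$ (the empty map allowed) that are isotone ($x\le y$ implies $x\alpha\le y\alpha$ for all $x,y\in\mathrm{Dom}\,\alpha$) and order-decreasing ($x\alpha\le x$ for all $x\in \mathrm{Dom}\,\alpha$), maps being written on the right and composed left to right: $x(\alpha\beta)=(x\alpha)\beta$. For a semigroup $S$ and $a,b\in S$: $a\,\mathcal{L}^*\,b$ iff for all $x,y\in S^1$, $ax=ay\Leftrightarrow bx=by$; $a\,\mathcal{R}^*\,b$ iff for all $x,y\in S^1$, $xa=ya\Leftrightarrow xb=yb$. $S$ is abundant if every $\mathcal{L}^*$-class and every $\mathcal{R}^*$-class contains an idempotent. An abundant semigroup $S$ is adequate if its set $E(S)$ of idempotents is a semilattice (a commutative subsemigroup); then for $a\in S$ the unique idempotent in the $\mathcal{L}^*$-class (respectively $\mathcal{R}^*$-class) of $a$ is denoted $a^*$ (respectively $a^+$). An adequate semigroup $S$ is ample if $ea=a(ea)^*$ and $ae=(ae)^+a$ for all $a\in S$ and all $e\in E(S)$. *)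

theory Defs
  imports "HOL-Algebra.Group"
begin

text \<open>
  Semigroups are represented by \<open>carrier\<close> and \<open>mult\<close> of the HOL-Algebra record \<open>monoid\<close>.  The
  notions defined for a semigroup \<open>S\<close> never refer to the field \<open>one\<close> of \<open>S\<close>, so that \<open>S\<close> need
  not have an identity.
\<close>

definition is_semigroup :: "('a, 'm) monoid_scheme \<Rightarrow> bool" where
  "is_semigroup S \<longleftrightarrow>
     (\<forall>x\<in>carrier S. \<forall>y\<in>carrier S. x \<otimes>\<^bsub>S\<^esub> y \<in> carrier S) \<and>
     (\<forall>x\<in>carrier S. \<forall>y\<in>carrier S. \<forall>z\<in>carrier S.
        (x \<otimes>\<^bsub>S\<^esub> y) \<otimes>\<^bsub>S\<^esub> z = x \<otimes>\<^bsub>S\<^esub> (y \<otimes>\<^bsub>S\<^esub> z))"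

definition is_identity :: "('a, 'm) monoid_scheme \<Rightarrow> 'a \<Rightarrow> bool" where
  "is_identity S e \<longleftrightarrow>
     e \<in> carrier S \<and> (\<forall>x\<in>carrier S. e \<otimes>\<^bsub>S\<^esub> x = x \<and> x \<otimes>\<^bsub>S\<^esub> e = x)"

text \<open>
  The monoid \<open>S\<^sup>1\<close>: the elements of \<open>S\<close> are embedded by \<open>Some\<close>, and the new identity \<open>None\<close>
  belongs to the carrier only if \<open>S\<close> has no identity of its own.
\<close>

definition with_one :: "('a, 'm) monoid_scheme \<Rightarrow> 'a option monoid" where
  "with_one S =
     \<lparr>carrier = (if \<exists>e. is_identity S e then Some ` carrier S
                  else insert None (Some ` carrier S)),
      mult = (\<lambda>u v. case u of None \<Rightarrow> v
                | Some x \<Rightarrow> (case v of None \<Rightarrow> u | Some y \<Rightarrow> Some (x \<otimes>\<^bsub>S\<^esub> y))),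
      one = (if \<exists>e. is_identity S e then Some (THE e. is_identity S e) else None)\<rparr>"

definition L_star :: "('a, 'm) monoid_scheme \<Rightarrow> ('a \<times> 'a) set" where
  "L_star S = {(a, b). a \<in> carrier S \<and> b \<in> carrier S \<and>
     (\<forall>x\<in>carrier (with_one S). \<forall>y\<in>carrier (with_one S).
        Some a \<otimes>\<^bsub>with_one S\<^esub> x = Some a \<otimes>\<^bsub>with_one S\<^esub> y \<longleftrightarrow>
        Some b \<otimes>\<^bsub>with_one S\<^esub> x = Some b \<otimes>\<^bsub>with_one S\<^esub> y)}"

definition R_star :: "('a, 'm) monoid_scheme \<Rightarrow> ('a \<times> 'a) set" where
  "R_star S = {(a, b). a \<in> carrier S \<and> b \<in> carrier S \<and>
     (\<forall>x\<in>carrier (with_one S). \<forall>y\<in>carrier (with_one S).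
        x \<otimes>\<^bsub>with_one S\<^esub> Some a = y \<otimes>\<^bsub>with_one S\<^esub> Some a \<longleftrightarrow>
        x \<otimes>\<^bsub>with_one S\<^esub> Some b = y \<otimes>\<^bsub>with_one S\<^esub> Some b)}"

definition idempotents :: "('a, 'm) monoid_scheme \<Rightarrow> 'a set" where
  "idempotents S = {e \<in> carrier S. e \<otimes>\<^bsub>S\<^esub> e = e}"

definition abundant :: "('a, 'm) monoid_scheme \<Rightarrow> bool" where
  "abundant S \<longleftrightarrow> is_semigroup S \<and>
     (\<forall>C \<in> carrier S // L_star S. \<exists>e\<in>idempotents S. e \<in> C) \<and>
     (\<forall>C \<in> carrier S // R_star S. \<exists>e\<in>idempotents S. e \<in> C)"

definition adequate :: "('a, 'm) monoid_scheme \<Rightarrow> bool" where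
  "adequate S \<longleftrightarrow> abundant S \<and>
     (\<forall>e\<in>idempotents S. \<forall>f\<in>idempotents S.
        e \<otimes>\<^bsub>S\<^esub> f \<in> idempotents S \<and> e \<otimes>\<^bsub>S\<^esub> f = f \<otimes>\<^bsub>S\<^esub> e)"

text \<open>
  \<open>star S a\<close> and \<open>plus S a\<close> are \<open>a\<^sup>*\<close> and \<open>a\<^sup>+\<close>; they are meaningful only for adequate \<open>S\<close>
  and \<open>a\<close> in its carrier, where the idempotent in question exists and is unique.
\<close>

definition star :: "('a, 'm) monoid_scheme \<Rightarrow> 'a \<Rightarrow> 'a" where
  "star S a = (THE e. e \<in> idempotents S \<and> (a, e) \<in> L_star S)"

definition plus :: "('a, 'm) monoid_scheme \<Rightarrow> 'a \<Rightarrow> 'a" where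
  "plus S a = (THE e. e \<in> idempotents S \<and> (a, e) \<in> R_star S)"

definition ample :: "('a, 'm) monoid_scheme \<Rightarrow> bool" where
  "ample S \<longleftrightarrow> adequate S \<and>
     (\<forall>a\<in>carrier S. \<forall>e\<in>idempotents S.
        e \<otimes>\<^bsub>S\<^esub> a = a \<otimes>\<^bsub>S\<^esub> star S (e \<otimes>\<^bsub>S\<^esub> a) \<and>
        a \<otimes>\<^bsub>S\<^esub> e = plus S (a \<otimes>\<^bsub>S\<^esub> e) \<otimes>\<^bsub>S\<^esub> a)"

text \<open>
  A partial transformation of \<open>[n]\<close> is a map \<open>nat \<rightharpoonup> nat\<close> with domain and range contained in
  \<open>{1..n}\<close>.  Maps act on the right, hence the product \<open>\<alpha>\<beta>\<close> is \<open>\<beta> \<circ>\<^sub>m \<alpha>\<close>.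
\<close>

definition isotone_map :: "(nat \<rightharpoonup> nat) \<Rightarrow> bool" where
  "isotone_map \<alpha> \<longleftrightarrow>
     (\<forall>x\<in>dom \<alpha>. \<forall>y\<in>dom \<alpha>. x \<le> y \<longrightarrow> the (\<alpha> x) \<le> the (\<alpha> y))"

definition order_decreasing :: "(nat \<rightharpoonup> nat) \<Rightarrow> bool" where
  "order_decreasing \<alpha> \<longleftrightarrow> (\<forall>x\<in>dom \<alpha>. the (\<alpha> x) \<le> x)"

definition IC :: "nat \<Rightarrow> (nat \<rightharpoonup> nat) monoid" where
  "IC n =
     \<lparr>carrier = {\<alpha>. dom \<alpha> \<subseteq> {1..n} \<and> ran \<alpha> \<subseteq> {1..n} \<and> inj_on \<alpha> (dom \<alpha>) \<and>
                    isotone_map \<alpha> \<and> order_decreasing \<alpha>},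
      mult = (\<lambda>\<alpha> \<beta>. \<beta> \<circ>\<^sub>m \<alpha>),
      one = (Some |` {1..n})\<rparr>"

end

theory Submission
  imports Defs
begin

text \<open>
  The idempotents of \<open>IC n\<close> are the identity maps of the subsets of \<open>[n]\<close>, which commute.  A
  product \<open>\<alpha>x\<close> depends only on the restriction of \<open>x\<close> to the range of \<open>\<alpha>\<close>, and, since \<open>\<alpha>\<close> is
  injective, \<open>x\<alpha>\<close> determines exactly the restriction of \<open>x\<close> to the points sent into the domain
  of \<open>\<alpha>\<close>.  Hence \<open>\<alpha>\<^sup>*\<close> and \<open>\<alpha>\<^sup>+\<close> are the identity maps of the range and the domain of \<open>\<alpha>\<close>, and
  the ample identities hold because \<open>\<alpha>\<close> is injective.
\<close>

section \<open>The star relations in a semigroup that has an identity\<close>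

lemma L_star_iff_of_identity:
  assumes "is_identity S e"
  shows "(a, b) \<in> L_star S \<longleftrightarrow> a \<in> carrier S \<and> b \<in> carrier S \<and>
    (\<forall>x\<in>carrier S. \<forall>y\<in>carrier S. a \<otimes>\<^bsub>S\<^esub> x = a \<otimes>\<^bsub>S\<^esub> y \<longleftrightarrow> b \<otimes>\<^bsub>S\<^esub> x = b \<otimes>\<^bsub>S\<^esub> y)"
proof -
  \<comment> \<open>An identity in \<open>S\<close> keeps \<open>None\<close> out of the carrier of
    \<open>with_one S\<close>, so every quantified element is \<open>Some x\<close> with
    \<open>x\<close> in \<open>S\<close>, and the wrapper cancels.\<close>
  have "\<exists>e. is_identity S e" using assms by blast
  then show ?thesis by (simp add: L_star_def with_one_def)
qed

lemma R_star_iff_of_identity: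
  assumes "is_identity S e"
  shows "(a, b) \<in> R_star S \<longleftrightarrow> a \<in> carrier S \<and> b \<in> carrier S \<and>
    (\<forall>x\<in>carrier S. \<forall>y\<in>carrier S. x \<otimes>\<^bsub>S\<^esub> a = y \<otimes>\<^bsub>S\<^esub> a \<longleftrightarrow> x \<otimes>\<^bsub>S\<^esub> b = y \<otimes>\<^bsub>S\<^esub> b)"
proof -
  have "\<exists>e. is_identity S e" using assms by blast
  then show ?thesis by (simp add: R_star_def with_one_def)
qed

section \<open>Cancellation in compositions of partial maps\<close>

lemma map_comp_left_cancel_iff: "x \<circ>\<^sub>m a = y \<circ>\<^sub>m a \<longleftrightarrow> (\<forall>z\<in>ran a. x z = y z)"
  by (auto simp: fun_eq_iff map_comp_def ran_def split: option.splits)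

text \<open>Composing with \<open>a\<close> erases the values of \<open>x\<close> outside
  \<open>dom a\<close>; a value inside can be recovered from its image because \<open>a\<close> is
  injective.\<close>

lemma map_comp_right_cancel_iff:
  assumes "inj_on a (dom a)"
  shows "a \<circ>\<^sub>m x = a \<circ>\<^sub>m y \<longleftrightarrow> (\<forall>t. \<forall>z\<in>dom a. x t = Some z \<longleftrightarrow> y t = Some z)"
proof
  assume eq: "a \<circ>\<^sub>m x = a \<circ>\<^sub>m y"
  \<comment> \<open>The equation is a premise of the auxiliary claim, with \<open>x\<close> and
    \<open>y\<close> generalized, so that its symmetric form yields the other direction.\<close>
  have "y t = Some z" if z: "z \<in> dom a" "x t = Some z" and eq: "a \<circ>\<^sub>m x = a \<circ>\<^sub>m y" for t z x y
  proof -
    obtain w where w: "a z = Some w" using z by blast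
    have "(a \<circ>\<^sub>m y) t = Some w" using z w eq by (metis map_comp_simps(2))
    then obtain v where v: "y t = Some v" "a v = Some w" by (auto simp: map_comp_Some_iff)
    with assms w have "v = z" by (auto dest!: inj_onD[of a "dom a" v z])
    with v show ?thesis by simp
  qed
  from this[OF _ _ eq] this[OF _ _ eq[symmetric]]
  show "\<forall>t. \<forall>z\<in>dom a. x t = Some z \<longleftrightarrow> y t = Some z" by blast
next
  assume *: "\<forall>t. \<forall>z\<in>dom a. x t = Some z \<longleftrightarrow> y t = Some z"
  then have "(a \<circ>\<^sub>m x) t = Some w \<longleftrightarrow> (a \<circ>\<^sub>m y) t = Some w" for t w
    unfolding map_comp_Some_iff by (metis domI)
  then show "a \<circ>\<^sub>m x = a \<circ>\<^sub>m y" by (metis ext not_Some_eq)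
qed

lemma map_comp_Some_restrict: "a \<circ>\<^sub>m (Some |` A) = a |` A"
  by (rule ext) (simp add: map_comp_def restrict_map_def)

lemma Some_restrict_map_comp_eq_iff: "(Some |` A) \<circ>\<^sub>m a = a \<longleftrightarrow> ran a \<subseteq> A"
proof -
  \<comment> \<open>Reading the right-hand \<open>a\<close> as \<open>Some \<circ>\<^sub>m a\<close>
    makes the equation a comparison of two maps applied after \<open>a\<close>, which need only
    agree on \<open>ran a\<close>.\<close>
  have "Some \<circ>\<^sub>m a = a" by (rule ext) (simp add: map_comp_def split: option.split)
  then have "(Some |` A) \<circ>\<^sub>m a = a \<longleftrightarrow> (\<forall>z\<in>ran a. (Some |` A) z = Some z)"
    using map_comp_left_cancel_iff[of "Some |` A" a Some] by simp
  also have "\<dots> \<longleftrightarrow> ran a \<subseteq> A" by (auto simp: restrict_map_def split: if_splits)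
  finally show ?thesis .
qed

lemma restrict_map_eq_self_iff: "a |` A = a \<longleftrightarrow> dom a \<subseteq> A"
proof
  assume "a |` A = a"
  then have "dom a = dom a \<inter> A" by (metis dom_restrict)
  then show "dom a \<subseteq> A" by blast
next
  assume "dom a \<subseteq> A"
  then show "a |` A = a" by (intro map_le_antisym) (auto simp: map_le_def)
qed

lemma dom_Some_restrict [simp]: "dom (Some |` A) = A"
  by (auto simp: restrict_map_def dom_def)

lemma ran_Some_restrict [simp]: "ran (Some |` A) = A"
  by (auto simp: restrict_map_def ran_def)

section \<open>The semigroup \<open>IC n\<close> and its idempotents\<close>

lemma mult_IC [simp]: "\<alpha> \<otimes>\<^bsub>IC n\<^esub> \<beta> = \<beta> \<circ>\<^sub>m \<alpha>"
  by (simp add: IC_def)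

lemma IC_dom: "\<alpha> \<in> carrier (IC n) \<Longrightarrow> dom \<alpha> \<subseteq> {1..n}"
  and IC_ran: "\<alpha> \<in> carrier (IC n) \<Longrightarrow> ran \<alpha> \<subseteq> {1..n}"
  and IC_inj: "\<alpha> \<in> carrier (IC n) \<Longrightarrow> inj_on \<alpha> (dom \<alpha>)"
  by (simp_all add: IC_def)

text \<open>This first-order form, in equations \<open>\<alpha> x = Some y\<close> without
  \<open>the\<close>, \<open>dom\<close> or \<open>ran\<close>, lets closure under products be
  checked by following points through intermediate values.\<close>

lemma IC_carrier_iff:
  "\<alpha> \<in> carrier (IC n) \<longleftrightarrow>
    (\<forall>x y. \<alpha> x = Some y \<longrightarrow> x \<in> {1..n} \<and> y \<in> {1..n} \<and> y \<le> x) \<and>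
    (\<forall>x x' y. \<alpha> x = Some y \<longrightarrow> \<alpha> x' = Some y \<longrightarrow> x = x') \<and>
    (\<forall>x x' y y'. \<alpha> x = Some y \<longrightarrow> \<alpha> x' = Some y' \<longrightarrow> x \<le> x' \<longrightarrow> y \<le> y')"
proof -
  have "inj_on \<alpha> (dom \<alpha>) \<longleftrightarrow> (\<forall>x x' y. \<alpha> x = Some y \<longrightarrow> \<alpha> x' = Some y \<longrightarrow> x = x')"
    by (auto simp: inj_on_def dom_def)
  moreover have "isotone_map \<alpha> \<longleftrightarrow>
      (\<forall>x x' y y'. \<alpha> x = Some y \<longrightarrow> \<alpha> x' = Some y' \<longrightarrow> x \<le> x' \<longrightarrow> y \<le> y')"
    by (fastforce simp: isotone_map_def dom_def)
  moreover have "order_decreasing \<alpha> \<longleftrightarrow> (\<forall>x y. \<alpha> x = Some y \<longrightarrow> y \<le> x)"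
    by (fastforce simp: order_decreasing_def dom_def)
  moreover have "dom \<alpha> \<subseteq> {1..n} \<longleftrightarrow> (\<forall>x y. \<alpha> x = Some y \<longrightarrow> x \<in> {1..n})"
    by (auto simp: dom_def)
  moreover have "ran \<alpha> \<subseteq> {1..n} \<longleftrightarrow> (\<forall>x y. \<alpha> x = Some y \<longrightarrow> y \<in> {1..n})"
    by (auto simp: ran_def)
  ultimately show ?thesis
    unfolding IC_def by (simp only: partial_object.simps mem_Collect_eq) meson
qed

lemma is_semigroup_IC: "is_semigroup (IC n)"
proof -
  have "\<beta> \<circ>\<^sub>m \<alpha> \<in> carrier (IC n)" if "\<alpha> \<in> carrier (IC n)" "\<beta> \<in> carrier (IC n)" for \<alpha> \<beta>
    unfolding IC_carrier_iff
  proof (intro conjI allI impI)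
    fix x y assume "(\<beta> \<circ>\<^sub>m \<alpha>) x = Some y"
    then obtain k where *: "\<alpha> x = Some k" "\<beta> k = Some y" unfolding map_comp_Some_iff by blast
    with that show "x \<in> {1..n}" "y \<in> {1..n}"
      unfolding IC_carrier_iff by blast+
    from * that have "y \<le> k" "k \<le> x" unfolding IC_carrier_iff by blast+
    then show "y \<le> x" by simp
  next
    fix x x' y assume "(\<beta> \<circ>\<^sub>m \<alpha>) x = Some y" "(\<beta> \<circ>\<^sub>m \<alpha>) x' = Some y"
    then obtain k k' where *: "\<alpha> x = Some k" "\<beta> k = Some y" "\<alpha> x' = Some k'" "\<beta> k' = Some y"
      unfolding map_comp_Some_iff by blast
    with that(2) have "k = k'" unfolding IC_carrier_iff by blast
    with * that(1) show "x = x'" unfolding IC_carrier_iff by blast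
  next
    fix x x' y y' assume "(\<beta> \<circ>\<^sub>m \<alpha>) x = Some y" "(\<beta> \<circ>\<^sub>m \<alpha>) x' = Some y'" "x \<le> x'"
    then obtain k k' where *: "\<alpha> x = Some k" "\<beta> k = Some y" "\<alpha> x' = Some k'" "\<beta> k' = Some y'"
      unfolding map_comp_Some_iff by blast
    with that(1) \<open>x \<le> x'\<close> have "k \<le> k'" unfolding IC_carrier_iff by blast
    with * that(2) show "y \<le> y'" unfolding IC_carrier_iff by blast
  qed
  moreover have "\<gamma> \<circ>\<^sub>m (\<beta> \<circ>\<^sub>m \<alpha>) = (\<gamma> \<circ>\<^sub>m \<beta>) \<circ>\<^sub>m \<alpha>" for \<alpha> \<beta> \<gamma> :: "nat \<rightharpoonup> nat"
    by (rule ext) (simp add: map_comp_def split: option.splits)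
  ultimately show ?thesis by (simp add: is_semigroup_def)
qed

lemma Some_restrict_in_IC: "A \<subseteq> {1..n} \<Longrightarrow> Some |` A \<in> carrier (IC n)"
  by (auto simp: IC_carrier_iff restrict_map_def split: if_splits)

lemma is_identity_IC: "is_identity (IC n) (Some |` {1..n})"
  unfolding is_identity_def mult_IC map_comp_Some_restrict Some_restrict_map_comp_eq_iff
    restrict_map_eq_self_iff
  using IC_dom IC_ran Some_restrict_in_IC by blast

lemma idempotents_IC: "idempotents (IC n) = (\<lambda>A. Some |` A) ` Pow {1..n}"
proof (intro equalityI subsetI)
  fix \<alpha> assume "\<alpha> \<in> idempotents (IC n)"
  then have car: "\<alpha> \<in> carrier (IC n)" and idem: "\<alpha> \<circ>\<^sub>m \<alpha> = \<alpha>"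
    by (auto simp: idempotents_def)
  have "\<alpha> x = Some x" if xy: "\<alpha> x = Some y" for x y
  proof -
    \<comment> \<open>Idempotency fixes every point of the range; then x and y have the same image
      y, and injectivity identifies them.\<close>
    have "\<alpha> y = Some y" using idem xy by (metis map_comp_simps(2))
    with car xy have "x = y" unfolding IC_carrier_iff by blast
    with xy show ?thesis by simp
  qed
  then have "\<alpha> = Some |` dom \<alpha>"
    by (intro ext) (auto simp: restrict_map_def dom_def)
  with IC_dom[OF car] show "\<alpha> \<in> (\<lambda>A. Some |` A) ` Pow {1..n}" by blast
next
  fix \<alpha> :: "nat \<rightharpoonup> nat" assume "\<alpha> \<in> (\<lambda>A. Some |` A) ` Pow {1..n}"
  then show "\<alpha> \<in> idempotents (IC n)"
    by (auto simp: idempotents_def Some_restrict_in_IC map_comp_Some_restrict)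
qed

section \<open>The star relations and the operations \<open>star\<close> and \<open>plus\<close> in
  \<open>IC n\<close>\<close>

lemma L_star_IC_iff:
  "(\<alpha>, \<beta>) \<in> L_star (IC n) \<longleftrightarrow> \<alpha> \<in> carrier (IC n) \<and> \<beta> \<in> carrier (IC n) \<and> ran \<alpha> = ran \<beta>"
proof -
  have sub: "ran \<beta> \<subseteq> ran \<alpha>"
    if car: "\<alpha> \<in> carrier (IC n)" "\<beta> \<in> carrier (IC n)"
      and eq: "\<forall>x\<in>carrier (IC n). \<forall>y\<in>carrier (IC n).
        x \<circ>\<^sub>m \<alpha> = y \<circ>\<^sub>m \<alpha> \<longleftrightarrow> x \<circ>\<^sub>m \<beta> = y \<circ>\<^sub>m \<beta>" for \<alpha> \<beta>
  proof -
    \<comment> \<open>The relation is tested on two idempotents: the partial identity on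
      \<open>ran \<alpha>\<close> and the identity of the monoid. Both fix \<alpha> as right
      factors, so they act alike on \<beta>; the second fixes \<beta>, hence so does the first,
      which forces the inclusion of ranges.\<close>
    have "(Some |` ran \<alpha>) \<circ>\<^sub>m \<alpha> = (Some |` {1..n}) \<circ>\<^sub>m \<alpha>"
      using IC_ran[OF car(1)] by (metis Some_restrict_map_comp_eq_iff order_refl)
    then have "(Some |` ran \<alpha>) \<circ>\<^sub>m \<beta> = (Some |` {1..n}) \<circ>\<^sub>m \<beta>"
      using eq IC_ran[OF car(1)] Some_restrict_in_IC by blast
    also have "\<dots> = \<beta>"
      using IC_ran[OF car(2)] by (simp only: Some_restrict_map_comp_eq_iff)
    finally show ?thesis by (simp only: Some_restrict_map_comp_eq_iff)
  qed
  show ?thesis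
  proof (intro iffI)
    assume "(\<alpha>, \<beta>) \<in> L_star (IC n)"
    then show "\<alpha> \<in> carrier (IC n) \<and> \<beta> \<in> carrier (IC n) \<and> ran \<alpha> = ran \<beta>"
      unfolding L_star_iff_of_identity[OF is_identity_IC] mult_IC
      using sub[of \<alpha> \<beta>] sub[of \<beta> \<alpha>] by blast
  next
    assume "\<alpha> \<in> carrier (IC n) \<and> \<beta> \<in> carrier (IC n) \<and> ran \<alpha> = ran \<beta>"
    then show "(\<alpha>, \<beta>) \<in> L_star (IC n)"
      by (simp add: L_star_iff_of_identity[OF is_identity_IC] map_comp_left_cancel_iff)
  qed
qed

text \<open>Dual to the previous argument, with the partial identity on \<open>dom \<alpha>\<close>
  as the test element on the left. The converse uses the injectivity of both maps, through which
  cancellation of a right factor depends on its domain alone.\<close>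

lemma R_star_IC_iff:
  "(\<alpha>, \<beta>) \<in> R_star (IC n) \<longleftrightarrow> \<alpha> \<in> carrier (IC n) \<and> \<beta> \<in> carrier (IC n) \<and> dom \<alpha> = dom \<beta>"
proof -
  have sub: "dom \<beta> \<subseteq> dom \<alpha>"
    if car: "\<alpha> \<in> carrier (IC n)" "\<beta> \<in> carrier (IC n)"
      and eq: "\<forall>x\<in>carrier (IC n). \<forall>y\<in>carrier (IC n).
        \<alpha> \<circ>\<^sub>m x = \<alpha> \<circ>\<^sub>m y \<longleftrightarrow> \<beta> \<circ>\<^sub>m x = \<beta> \<circ>\<^sub>m y" for \<alpha> \<beta>
  proof -
    have "\<alpha> \<circ>\<^sub>m (Some |` dom \<alpha>) = \<alpha> \<circ>\<^sub>m (Some |` {1..n})"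
      using IC_dom[OF car(1)] by (metis map_comp_Some_restrict restrict_map_eq_self_iff order_refl)
    then have "\<beta> \<circ>\<^sub>m (Some |` dom \<alpha>) = \<beta> \<circ>\<^sub>m (Some |` {1..n})"
      using eq IC_dom[OF car(1)] Some_restrict_in_IC by blast
    also have "\<dots> = \<beta>"
      using IC_dom[OF car(2)] by (simp only: map_comp_Some_restrict restrict_map_eq_self_iff)
    finally show ?thesis by (simp only: map_comp_Some_restrict restrict_map_eq_self_iff)
  qed
  show ?thesis
  proof (intro iffI)
    assume "(\<alpha>, \<beta>) \<in> R_star (IC n)"
    then show "\<alpha> \<in> carrier (IC n) \<and> \<beta> \<in> carrier (IC n) \<and> dom \<alpha> = dom \<beta>"
      unfolding R_star_iff_of_identity[OF is_identity_IC] mult_IC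
      using sub[of \<alpha> \<beta>] sub[of \<beta> \<alpha>] by blast
  next
    assume *: "\<alpha> \<in> carrier (IC n) \<and> \<beta> \<in> carrier (IC n) \<and> dom \<alpha> = dom \<beta>"
    then have "inj_on \<alpha> (dom \<alpha>)" "inj_on \<beta> (dom \<beta>)" using IC_inj by blast+
    with * show "(\<alpha>, \<beta>) \<in> R_star (IC n)"
      by (simp only: R_star_iff_of_identity[OF is_identity_IC] mult_IC map_comp_right_cancel_iff)
        simp
  qed
qed

text \<open>The equivalence gives existence and uniqueness together: the first supplies the
  idempotent that abundance asks for, and both evaluate the definite description in
  \<open>star\<close>.\<close>

lemma idempotent_L_star_IC:
  assumes "\<alpha> \<in> carrier (IC n)"
  shows "e \<in> idempotents (IC n) \<and> (\<alpha>, e) \<in> L_star (IC n) \<longleftrightarrow> e = Some |` ran \<alpha>"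
proof
  assume "e \<in> idempotents (IC n) \<and> (\<alpha>, e) \<in> L_star (IC n)"
  then show "e = Some |` ran \<alpha>"
    unfolding idempotents_IC L_star_IC_iff by (metis ran_Some_restrict imageE)
next
  assume "e = Some |` ran \<alpha>"
  then show "e \<in> idempotents (IC n) \<and> (\<alpha>, e) \<in> L_star (IC n)"
    using assms IC_ran[OF assms]
    by (simp add: idempotents_IC L_star_IC_iff Some_restrict_in_IC)
qed

lemma idempotent_R_star_IC:
  assumes "\<alpha> \<in> carrier (IC n)"
  shows "e \<in> idempotents (IC n) \<and> (\<alpha>, e) \<in> R_star (IC n) \<longleftrightarrow> e = Some |` dom \<alpha>"
proof
  assume "e \<in> idempotents (IC n) \<and> (\<alpha>, e) \<in> R_star (IC n)"
  then show "e = Some |` dom \<alpha>"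
    unfolding idempotents_IC R_star_IC_iff by (metis dom_Some_restrict imageE)
next
  assume "e = Some |` dom \<alpha>"
  then show "e \<in> idempotents (IC n) \<and> (\<alpha>, e) \<in> R_star (IC n)"
    using assms IC_dom[OF assms]
    by (simp add: idempotents_IC R_star_IC_iff Some_restrict_in_IC)
qed

lemma star_IC: "\<alpha> \<in> carrier (IC n) \<Longrightarrow> star (IC n) \<alpha> = Some |` ran \<alpha>"
  by (simp add: star_def idempotent_L_star_IC)

lemma plus_IC: "\<alpha> \<in> carrier (IC n) \<Longrightarrow> plus (IC n) \<alpha> = Some |` dom \<alpha>"
  by (simp add: plus_def idempotent_R_star_IC)

section \<open>Adequacy and the ample identities\<close>

lemma adequate_IC: "adequate (IC n)"
proof -
  have "\<exists>e\<in>idempotents (IC n). e \<in> C" if "C \<in> carrier (IC n) // L_star (IC n)" for C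
  proof -
    from that obtain \<alpha> where "\<alpha> \<in> carrier (IC n)" "C = L_star (IC n) `` {\<alpha>}"
      by (rule quotientE)
    then show ?thesis using idempotent_L_star_IC[of \<alpha> n "Some |` ran \<alpha>"] by blast
  qed
  moreover have "\<exists>e\<in>idempotents (IC n). e \<in> C" if "C \<in> carrier (IC n) // R_star (IC n)" for C
  proof -
    from that obtain \<alpha> where "\<alpha> \<in> carrier (IC n)" "C = R_star (IC n) `` {\<alpha>}"
      by (rule quotientE)
    then show ?thesis using idempotent_R_star_IC[of \<alpha> n "Some |` dom \<alpha>"] by blast
  qed
  ultimately have "abundant (IC n)"
    by (simp add: abundant_def is_semigroup_IC)
  moreover have "e \<otimes>\<^bsub>IC n\<^esub> f \<in> idempotents (IC n) \<and> e \<otimes>\<^bsub>IC n\<^esub> f = f \<otimes>\<^bsub>IC n\<^esub> e"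
    if "e \<in> idempotents (IC n)" "f \<in> idempotents (IC n)" for e f
  proof -
    obtain A B where "A \<subseteq> {1..n}" "e = Some |` A" "f = Some |` B"
      using \<open>e \<in> idempotents (IC n)\<close> \<open>f \<in> idempotents (IC n)\<close> unfolding idempotents_IC by blast
    \<comment> \<open>The product in either order is the partial identity on the intersection of A
      and B, which lies in [n] because A does.\<close>
    moreover from this have "Some |` (A \<inter> B) \<in> idempotents (IC n)"
      unfolding idempotents_IC by blast
    ultimately show ?thesis
      by (simp add: map_comp_Some_restrict Int_commute)
  qed
  ultimately show ?thesis
    unfolding adequate_def by blast
qed

text \<open>This is the first ample identity, for e the partial identity on A: \<open>a\<close>
  restricted to A is the product of e and \<open>a\<close>. By injectivity, a point that
  \<open>a\<close> sends into the image of A already belongs to A.\<close>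

lemma Some_ran_restrict_map_comp:
  assumes "inj_on a (dom a)"
  shows "(Some |` ran (a |` A)) \<circ>\<^sub>m a = a |` A"
proof
  fix x
  show "((Some |` ran (a |` A)) \<circ>\<^sub>m a) x = (a |` A) x"
  proof (cases "a x")
    case None
    then show ?thesis by (simp add: restrict_map_def)
  next
    case (Some y)
    have "y \<in> ran (a |` A) \<longleftrightarrow> x \<in> A"
    proof
      assume "y \<in> ran (a |` A)"
      then obtain x' where "x' \<in> A" "a x' = Some y"
        unfolding ran_def restrict_map_def by (auto split: if_splits)
      moreover from this Some assms have "x' = x" by (metis domI inj_onD)
      ultimately show "x \<in> A" by simp
    next
      assume "x \<in> A"
      then show "y \<in> ran (a |` A)" using Some by (intro ranI[of _ x]) simp
    qed
    with Some show ?thesis by (simp add: restrict_map_def)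
  qed
qed

text \<open>This is the second ample identity: following \<open>a\<close> by a partial identity
  changes no value and only shrinks the domain, so the product is the restriction of
  \<open>a\<close> to the domain of the product.\<close>

lemma restrict_dom_Some_restrict_map_comp:
  "a |` dom ((Some |` A) \<circ>\<^sub>m a) = (Some |` A) \<circ>\<^sub>m a"
proof
  fix x
  show "(a |` dom ((Some |` A) \<circ>\<^sub>m a)) x = ((Some |` A) \<circ>\<^sub>m a) x"
    by (cases "a x") (auto simp: restrict_map_def dom_def)
qed

theorem theorem2p11:
  fixes n :: nat
  assumes "n \<ge> 2"
  shows "ample (IC n)"
proof -
  have "e \<otimes>\<^bsub>IC n\<^esub> \<alpha> = \<alpha> \<otimes>\<^bsub>IC n\<^esub> star (IC n) (e \<otimes>\<^bsub>IC n\<^esub> \<alpha>) \<and>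
      \<alpha> \<otimes>\<^bsub>IC n\<^esub> e = plus (IC n) (\<alpha> \<otimes>\<^bsub>IC n\<^esub> e) \<otimes>\<^bsub>IC n\<^esub> \<alpha>"
    if \<alpha>: "\<alpha> \<in> carrier (IC n)" and e: "e \<in> idempotents (IC n)" for \<alpha> e
  proof -
    have "e \<in> carrier (IC n)" using e by (simp add: idempotents_def)
    with \<alpha> is_semigroup_IC[of n] have "e \<otimes>\<^bsub>IC n\<^esub> \<alpha> \<in> carrier (IC n)" "\<alpha> \<otimes>\<^bsub>IC n\<^esub> e \<in> carrier (IC n)"
      unfolding is_semigroup_def by blast+
    then have "star (IC n) (e \<otimes>\<^bsub>IC n\<^esub> \<alpha>) = Some |` ran (e \<otimes>\<^bsub>IC n\<^esub> \<alpha>)"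
      "plus (IC n) (\<alpha> \<otimes>\<^bsub>IC n\<^esub> e) = Some |` dom (\<alpha> \<otimes>\<^bsub>IC n\<^esub> e)"
      using star_IC plus_IC by blast+
    moreover obtain A where "e = Some |` A"
      using e unfolding idempotents_IC by blast
    ultimately show ?thesis
      by (simp only: mult_IC map_comp_Some_restrict Some_ran_restrict_map_comp[OF IC_inj[OF \<alpha>]]
          restrict_dom_Some_restrict_map_comp simp_thms)
  qed
  then show ?thesis
    using adequate_IC[of n] unfolding ample_def by blast
qed

end
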